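(* Let $(\mathfrak g,\mu,T,B)$ be a quadratic Hom-Lie algebra over $\mathbb F$ such that $T$ is a centroid and $\dim\operatorname{Ker}(T)=r>0$. Let $V$ be an $r$-dimensional vector space, and let $\mathfrak G=\mathfrak g\oplus V$, the quadratic Lie algebra $(\mathfrak G,[\,\cdot\,,\,\cdot\,]_{\mathfrak G},B_{\mathfrak G})$, the Hom-Lie algebra $(\mathfrak G,\mu_{\mathfrak G},L)$ and the product $(x,y)\mapsto xy$ on $\mathfrak G$ be as constructed in the context. (i) Let $\mathcal A=\mathbb F\times\mathfrak G$ and define the following multiplication in $\mathcal A$: $$(\xi,x)(\eta,y)=\bigl(\xi\eta+B_{\mathfrak G}(x,y),\ \xi y+\eta x+xy\bigr),\qquad \xi,\eta\in\mathbb F,\ x,y\in\mathfrak G.$$ Then $\mathcal A$ is a non-abelian (i.e. non-commutative), and in general a non-associative, algebra with unit element $1_{\mathcal A}=(1,0)$. (ii) If $\mu$ is not a Lie product and the Lie algebra $(\mathfrak g,[\,\cdot\,,\,\cdot\,]=T\circ\mu)$ is not Abelian, then $\mathcal A$ has no non-trivial two-sided ideals. Furthermore, if $(\mathfrak g,[\,\cdot\,,\,\cdot\,])$ is nilpotent, then $\mathcal A$ is simple. (iii) Let $\mathcal A'=\mathcal A/\mathbb F\,1_{\mathcal A}$ (quotient vector space), let $\mu':\mathcal A'\times\mathcal A'\to\mathcal A'$ be defined by $$\mu'\bigl((\xi,x)+\mathbb F1_{\mathcal A},(\eta,y)+\mathbb F1_{\mathcal A}\bigr)=(\xi,x)(\eta,y)-(\eta,y)(\xi,x)+\mathbb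 F1_{\mathcal A},$$ for all $\xi,\eta\in\mathbb F$ and $x,y\in\mathfrak G$, and let $T':\mathcal A'\to\mathcal A'$ be the linear map defined by $T'((\xi,x)+\mathbb F1_{\mathcal A})=(\xi,L(x))+\mathbb F1_{\mathcal A}$. Then $(\mathcal A',\mu',T')$ is a Hom-Lie algebra isomorphic to $(\mathfrak G,\mu_{\mathfrak G},L)$.
   Context: All vector spaces are finite dimensional over an algebraically closed field $\mathbb F$ of characteristic zero. A Hom-Lie algebra is a triple $(\mathfrak g,\mu,T)$ with $\mathfrak g$ a vector space, $\mu:\mathfrak g\times\mathfrak g\to\mathfrak g$ bilinear and skew-symmetric, and $T:\mathfrak g\to\mathfrak g$ linear, such that $\mu(T(x),\mu(y,z))+\mu(T(y),\mu(z,x))+\mu(T(z),\mu(x,y))=0$ for all $x,y,z\in\mathfrak g$. An isomorphism of Hom-Lie algebras $(\mathfrak g_1,\mu_1,T_1)\to(\mathfrak g_2,\mu_2,T_2)$ is a linear bijection $\psi$ with $\psi(\mu_1(x,y))=\mu_2(\psi(x),\psi(y))$ and $\psi\circ T_1=T_2\circ\psi$. $T$ is a centroid of $(\mathfrak g,\mu)$ if $T(\mu(x,y))=\mu(T(x),y)$ for all $x,y$. A quadratic Hom-Lie algebra $(\mathfrak g,\mu,T,B)$ is a Hom-Lie algebra with a symmetric non-degenerate bilinear form $B$ on $\mathfrak g$ such that $B(\mu(x,y),z)=B(x,\mu(y,z))$ and $B(T(x),y)=B(x,T(y))$ for all $x,y,z$. When $T$ is a centroid, $[x,y]=T(\mu(x,y))$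 is a Lie bracket on $\mathfrak g$ for which $B$ is invariant. "$\mu$ is not a Lie product" means $\mu$ does not satisfy the Jacobi identity. Construction. Choose a subspace $\mathfrak a\subset\mathfrak g$ complementary to $\operatorname{Im}(T)$ (so $\dim\mathfrak a=r$), a basis $a_1,\dots,a_r$ of $\mathfrak a$ and a basis $v_1,\dots,v_r$ of $V$. Define $k:\mathfrak g\to\mathfrak G$ by $k(x)=T(x)+B(a_1,x)v_1+\cdots+B(a_r,x)v_r$, and $[x+u,y+v]_{\mathfrak G}=k(\mu(x,y))$ for $x,y\in\mathfrak g$, $u,v\in V$. Define the symmetric bilinear form $B_{\mathfrak G}$ on $\mathfrak G=\mathfrak a\oplus\operatorname{Im}(T)\oplus V$ by $B_{\mathfrak G}(T(x),T(y))=B(T(x),y)$ for $x,y\in\mathfrak g$; $B_{\mathfrak G}(\mathfrak a\oplus V,\operatorname{Im}(T))=B_{\mathfrak G}(\mathfrak a,\mathfrak a)=B_{\mathfrak G}(V,V)=\{0\}$; $B_{\mathfrak G}(a_i,v_j)=\delta_{ij}$. Then $(\mathfrak G,[\,\cdot\,,\,\cdot\,]_{\mathfrak G},B_{\mathfrak G})$ is a quadratic Lie algebra (a Lie algebra with a non-degenerate symmetric invariant bilinear form). Define $\mu_{\mathfrak G}(x+u,y+v)=\mu(x,y)$ and $L(x+u)=k(x)$ for $x,y\in\mathfrak g$, $u,v\in V$; then $(\mathfrak G,\mu_{\mathfrak G},L)$ is a Hom-Lie algebra. Let $h:\mathfrak G\to\mathfrak g$ be the linear map determined by $B(h(x),y)=B_{\mathfrak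 G}(x,y)$ for all $x\in\mathfrak G$, $y\in\mathfrak g$. The product on $\mathfrak G$ is $xy=\tfrac12\bigl(\mu_{\mathfrak G}(x,y)-[h(x),y]_{\mathfrak G}+[x,h(y)]_{\mathfrak G}\bigr)$; it satisfies $xy-yx=\mu_{\mathfrak G}(x,y)$. An ideal (two-sided, left or right) of $\mathcal A$ is non-trivial if it is different from $\{0\}$ and $\mathcal A$. Here "simple" means having no non-trivial left ideals and no non-trivial right ideals.
   Formalization: In (i), non-commutativity of A is claimed only when μ is not identically zero: for μ = 0 (e.g. g = F, T = 0, r = 1) A is commutative. Non-associativity is proved for all data rather than "in general". *)

theory Defs
  imports "HOL-Analysis.Product_Vector" "HOL-Computational_Algebra.Polynomial"
begin

section \<open>Vector spaces and algebras\<close>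

locale fd_vector_space = vector_space scale
  for scale :: "'f::field \<Rightarrow> 'a::ab_group_add \<Rightarrow> 'a" (infixr \<open>*s\<close> 75) +
  assumes finite_dim: "\<exists>Basis. finite_dimensional_vector_space scale Basis"

definition bilinear_map ::
  "('f::field \<Rightarrow> 'a::ab_group_add \<Rightarrow> 'a) \<Rightarrow> ('f \<Rightarrow> 'b::ab_group_add \<Rightarrow> 'b) \<Rightarrow>
   ('f \<Rightarrow> 'c::ab_group_add \<Rightarrow> 'c) \<Rightarrow> ('a \<Rightarrow> 'b \<Rightarrow> 'c) \<Rightarrow> bool" where
  "bilinear_map s1 s2 s3 f \<longleftrightarrow>
     (\<forall>x. Vector_Spaces.linear s2 s3 (\<lambda>y. f x y)) \<and>
     (\<forall>y. Vector_Spaces.linear s1 s3 (\<lambda>x. f x y))"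

definition indexed_basis ::
  "('f::field \<Rightarrow> 'a::ab_group_add \<Rightarrow> 'a) \<Rightarrow> nat \<Rightarrow> (nat \<Rightarrow> 'a) \<Rightarrow> 'a set \<Rightarrow> bool" where
  "indexed_basis s r b S \<longleftrightarrow>
     inj_on b {1..r} \<and> \<not> module.dependent s (b ` {1..r}) \<and> module.span s (b ` {1..r}) = S"

definition complementary ::
  "('f::field \<Rightarrow> 'a::ab_group_add \<Rightarrow> 'a) \<Rightarrow> 'a set \<Rightarrow> 'a set \<Rightarrow> bool" where
  "complementary s S U \<longleftrightarrow>
     module.subspace s S \<and> module.subspace s U \<and> S \<inter> U = {0} \<and> {x + y |x y. x \<in> S \<and> y \<in> U} = UNIV"

text \<open>Associativity is not assumed.\<close>

locale unital_algebra = fd_vector_space scale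
  for scale :: "'f::field \<Rightarrow> 'a::ab_group_add \<Rightarrow> 'a" (infixr \<open>*s\<close> 75) +
  fixes mult :: "'a \<Rightarrow> 'a \<Rightarrow> 'a" and one :: 'a
  assumes bilinear_mult: "bilinear_map scale scale scale mult"
    and one_left: "mult one x = x"
    and one_right: "mult x one = x"

definition left_ideal ::
  "('f::field \<Rightarrow> 'a::ab_group_add \<Rightarrow> 'a) \<Rightarrow> ('a \<Rightarrow> 'a \<Rightarrow> 'a) \<Rightarrow> 'a set \<Rightarrow> bool" where
  "left_ideal s m I \<longleftrightarrow> module.subspace s I \<and> (\<forall>a. \<forall>x\<in>I. m a x \<in> I)"

definition right_ideal ::
  "('f::field \<Rightarrow> 'a::ab_group_add \<Rightarrow> 'a) \<Rightarrow> ('a \<Rightarrow> 'a \<Rightarrow> 'a) \<Rightarrow> 'a set \<Rightarrow> bool" where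
  "right_ideal s m I \<longleftrightarrow> module.subspace s I \<and> (\<forall>a. \<forall>x\<in>I. m x a \<in> I)"

definition two_sided_ideal ::
  "('f::field \<Rightarrow> 'a::ab_group_add \<Rightarrow> 'a) \<Rightarrow> ('a \<Rightarrow> 'a \<Rightarrow> 'a) \<Rightarrow> 'a set \<Rightarrow> bool" where
  "two_sided_ideal s m I \<longleftrightarrow> left_ideal s m I \<and> right_ideal s m I"

definition nontrivial_ideal :: "'a::zero set \<Rightarrow> bool" where
  "nontrivial_ideal I \<longleftrightarrow> I \<noteq> {0} \<and> I \<noteq> UNIV"

text \<open>One-sided ideals are excluded here, which is stronger than the usual notion of a simple algebra.\<close>

definition simple_algebra ::
  "('f::field \<Rightarrow> 'a::ab_group_add \<Rightarrow> 'a) \<Rightarrow> ('a \<Rightarrow> 'a \<Rightarrow> 'a) \<Rightarrow> bool" where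
  "simple_algebra s m \<longleftrightarrow>
     (\<nexists>I. left_ideal s m I \<and> nontrivial_ideal I) \<and>
     (\<nexists>I. right_ideal s m I \<and> nontrivial_ideal I)"


section \<open>Lie and Hom-Lie algebras\<close>

definition jacobi :: "('a::ab_group_add \<Rightarrow> 'a \<Rightarrow> 'a) \<Rightarrow> bool" where
  "jacobi br \<longleftrightarrow> (\<forall>x y z. br x (br y z) + br y (br z x) + br z (br x y) = 0)"

definition abelian_bracket :: "('a::ab_group_add \<Rightarrow> 'a \<Rightarrow> 'a) \<Rightarrow> bool" where
  "abelian_bracket br \<longleftrightarrow> (\<forall>x y. br x y = 0)"

primrec lower_central_series ::
  "('f::field \<Rightarrow> 'a::ab_group_add \<Rightarrow> 'a) \<Rightarrow> ('a \<Rightarrow> 'a \<Rightarrow> 'a) \<Rightarrow> nat \<Rightarrow> 'a set" where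
  "lower_central_series s br 0 = UNIV"
| "lower_central_series s br (Suc n) =
     module.span s {br x y |x y. y \<in> lower_central_series s br n}"

definition nilpotent_bracket ::
  "('f::field \<Rightarrow> 'a::ab_group_add \<Rightarrow> 'a) \<Rightarrow> ('a \<Rightarrow> 'a \<Rightarrow> 'a) \<Rightarrow> bool" where
  "nilpotent_bracket s br \<longleftrightarrow> (\<exists>n. lower_central_series s br n = {0})"

locale hom_lie_algebra = fd_vector_space scale
  for scale :: "'f::field \<Rightarrow> 'a::ab_group_add \<Rightarrow> 'a" (infixr \<open>*s\<close> 75) +
  fixes \<mu> :: "'a \<Rightarrow> 'a \<Rightarrow> 'a" and T :: "'a \<Rightarrow> 'a"
  assumes bilinear_mu: "bilinear_map scale scale scale \<mu>"
    and skew_mu: "\<mu> x y = - \<mu> y x"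
    and linear_T: "Vector_Spaces.linear scale scale T"
    and hom_jacobi: "\<mu> (T x) (\<mu> y z) + \<mu> (T y) (\<mu> z x) + \<mu> (T z) (\<mu> x y) = 0"

definition hom_lie_isomorphism ::
  "('f::field \<Rightarrow> 'a::ab_group_add \<Rightarrow> 'a) \<Rightarrow> ('a \<Rightarrow> 'a \<Rightarrow> 'a) \<Rightarrow> ('a \<Rightarrow> 'a) \<Rightarrow>
   ('f \<Rightarrow> 'b::ab_group_add \<Rightarrow> 'b) \<Rightarrow> ('b \<Rightarrow> 'b \<Rightarrow> 'b) \<Rightarrow> ('b \<Rightarrow> 'b) \<Rightarrow> ('a \<Rightarrow> 'b) \<Rightarrow> bool" where
  "hom_lie_isomorphism s1 \<mu>1 T1 s2 \<mu>2 T2 \<psi> \<longleftrightarrow>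
     Vector_Spaces.linear s1 s2 \<psi> \<and> bij \<psi> \<and>
     (\<forall>x y. \<psi> (\<mu>1 x y) = \<mu>2 (\<psi> x) (\<psi> y)) \<and> \<psi> \<circ> T1 = T2 \<circ> \<psi>"

definition centroid :: "('a \<Rightarrow> 'a \<Rightarrow> 'a) \<Rightarrow> ('a \<Rightarrow> 'a) \<Rightarrow> bool" where
  "centroid \<mu> T \<longleftrightarrow> (\<forall>x y. T (\<mu> x y) = \<mu> (T x) y)"

locale quadratic_hom_lie_algebra = hom_lie_algebra scale \<mu> T
  for scale :: "'f::field \<Rightarrow> 'a::ab_group_add \<Rightarrow> 'a" (infixr \<open>*s\<close> 75) and \<mu> T +
  fixes B :: "'a \<Rightarrow> 'a \<Rightarrow> 'f"
  assumes bilinear_B: "bilinear_map scale scale (*) B"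
    and sym_B: "B x y = B y x"
    and nondegenerate_B: "(\<And>y. B x y = 0) \<Longrightarrow> x = 0"
    and invariant_B: "B (\<mu> x y) z = B x (\<mu> y z)"
    and selfadjoint_T: "B (T x) y = B x (T y)"


section \<open>The extension of a quadratic Hom-Lie algebra by \<open>V\<close>\<close>

text \<open>
  The spaces \<open>\<gg>\<close> and \<open>V\<close> are the types \<open>'g\<close> and \<open>'v\<close>; the sum of \<open>\<gg>\<close> and \<open>V\<close> is the product
  type, so that \<open>x + u\<close> is written \<open>(x, u)\<close>.
\<close>

locale hom_lie_extension = quadratic_hom_lie_algebra scale \<mu> T B + V: fd_vector_space scaleV
  for scale :: "'f::{alg_closed_field, field_char_0} \<Rightarrow> 'g::ab_group_add \<Rightarrow> 'g" (infixr \<open>*s\<close> 75)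
    and \<mu> T B
    and scaleV :: "'f \<Rightarrow> 'v::ab_group_add \<Rightarrow> 'v" (infixr \<open>*v\<close> 75) +
  fixes r :: nat and \<aa> :: "'g set" and a :: "nat \<Rightarrow> 'g" and v :: "nat \<Rightarrow> 'v"
  assumes centroid_T: "centroid \<mu> T"
    and dim_Ker_T: "dim {x. T x = 0} = r"
    and r_pos: "r > 0"
    and dim_V: "V.dim UNIV = r"
    and complementary_a: "complementary scale \<aa> (range T)"
    and basis_a: "indexed_basis scale r a \<aa>"
    and basis_v: "indexed_basis scaleV r v UNIV"
begin

abbreviation scaleG :: "'f \<Rightarrow> 'g \<times> 'v \<Rightarrow> 'g \<times> 'v" where
  "scaleG \<equiv> module_prod.scale scale scaleV"

definition k :: "'g \<Rightarrow> 'g \<times> 'v" where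
  "k x = (T x, \<Sum>i=1..r. B (a i) x *v v i)"

definition bracketG :: "'g \<times> 'v \<Rightarrow> 'g \<times> 'v \<Rightarrow> 'g \<times> 'v" where
  "bracketG X Y = k (\<mu> (fst X) (fst Y))"

definition is_formG :: "('g \<times> 'v \<Rightarrow> 'g \<times> 'v \<Rightarrow> 'f) \<Rightarrow> bool" where
  "is_formG \<beta> \<longleftrightarrow>
     bilinear_map scaleG scaleG (*) \<beta> \<and> (\<forall>X Y. \<beta> X Y = \<beta> Y X) \<and>
     (\<forall>x y. \<beta> (T x, 0) (T y, 0) = B (T x) y) \<and>
     (\<forall>x\<in>\<aa>. \<forall>u y. \<beta> (x, u) (T y, 0) = 0) \<and>
     (\<forall>x\<in>\<aa>. \<forall>y\<in>\<aa>. \<beta> (x, 0) (y, 0) = 0) \<and>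
     (\<forall>u w. \<beta> (0, u) (0, w) = 0) \<and>
     (\<forall>i\<in>{1..r}. \<forall>j\<in>{1..r}. \<beta> (a i, 0) (0, v j) = (if i = j then 1 else 0))"

definition BG :: "'g \<times> 'v \<Rightarrow> 'g \<times> 'v \<Rightarrow> 'f" where
  "BG = (THE \<beta>. is_formG \<beta>)"

lemma linear_simps:
  "T (x + y) = T x + T y" "T (c *s x) = c *s T x" "T 0 = 0"
  "B (x + y) z = B x z + B y z" "B (c *s x) z = c * B x z" "B 0 z = 0"
  "B z (x + y) = B z x + B z y" "B z (c *s x) = c * B z x" "B z 0 = 0"
proof -
  interpret T: Vector_Spaces.linear scale scale T by (rule linear_T)
  show "T (x + y) = T x + T y" "T (c *s x) = c *s T x" "T 0 = 0"
    by (simp_all add: T.add T.scale)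
  interpret B1: Vector_Spaces.linear scale "(*)" "\<lambda>x. B x z"
    using bilinear_B by (simp add: bilinear_map_def)
  interpret B2: Vector_Spaces.linear scale "(*)" "\<lambda>x. B z x"
    using bilinear_B by (simp add: bilinear_map_def)
  show "B (x + y) z = B x z + B y z" "B (c *s x) z = c * B x z" "B 0 z = 0"
    by (simp_all add: B1.add B1.scale)
  show "B z (x + y) = B z x + B z y" "B z (c *s x) = c * B z x" "B z 0 = 0"
    by (simp_all add: B2.add B2.scale)
qed

lemma vector_space_G: "vector_space scaleG"
proof -
  interpret vector_space_prod scale scaleV by unfold_locales
  show ?thesis by unfold_locales
qed

lemma scaleG_Pair: "scaleG c (x, u) = (c *s x, c *v u)"
proof -
  interpret vector_space_prod scale scaleV by unfold_locales
  show ?thesis by (simp add: scale_prod)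
qed

lemma vector_space_field: "vector_space ((*) :: 'f \<Rightarrow> 'f \<Rightarrow> 'f)"
  by unfold_locales (auto simp: algebra_simps)

lemma is_formG_linear:
  assumes "is_formG \<beta>"
  shows "Vector_Spaces.linear scaleG (*) (\<beta> X)" "Vector_Spaces.linear scaleG (*) (\<lambda>Y. \<beta> Y X)"
    "\<beta> X Y = \<beta> Y X"
  using assms unfolding is_formG_def bilinear_map_def by blast+

lemma is_formG_exists: "\<exists>\<beta>. is_formG \<beta>"
proof -
  interpret F: vector_space "(*) :: 'f \<Rightarrow> 'f \<Rightarrow> 'f" by (rule vector_space_field)
  interpret gg: vector_space_pair scale scale by unfold_locales
  interpret gF: vector_space_pair scale "(*) :: 'f \<Rightarrow> 'f \<Rightarrow> 'f" by unfold_locales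
  interpret vF: vector_space_pair scaleV "(*) :: 'f \<Rightarrow> 'f \<Rightarrow> 'f" by unfold_locales
  have a: "inj_on a {1..r}" "independent (a ` {1..r})" "span (a ` {1..r}) = \<aa>"
    using basis_a by (auto simp: indexed_basis_def)
  have v: "inj_on v {1..r}" "V.independent (v ` {1..r})"
    using basis_v by (auto simp: indexed_basis_def)
  have R: "subspace (range T)" "\<aa> \<inter> range T = {0}"
    using complementary_a by (auto simp: complementary_def)
  obtain C where C: "C \<subseteq> range T" "independent C" "range T \<subseteq> span C"
    by (rule basis_exists[of "range T"])
  have spC: "span C = range T"
    using span_minimal[OF C(1) R(1)] C(3) by (rule subset_antisym)
  have "0 \<notin> C" using C(2) dependent_zero by blast
  have disj: "a ` {1..r} \<inter> C = {}"
  proof (rule equals0I)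
    fix x assume "x \<in> a ` {1..r} \<inter> C"
    then have "x \<in> \<aa> \<inter> range T" "x \<in> C" using a(3) span_base C(1) by auto
    then show False using R(2) \<open>0 \<notin> C\<close> by auto
  qed
  have "finite C"
    using finite_dim C(2) finite_dimensional_vector_space.finiteI_independent by blast
  have ind: "independent (a ` {1..r} \<union> C)"
  proof (rule independent_if_scalars_zero)
    show "finite (a ` {1..r} \<union> C)" using \<open>finite C\<close> by simp
    fix c x
    assume sum0: "(\<Sum>x\<in>a ` {1..r} \<union> C. c x *s x) = 0" and x: "x \<in> a ` {1..r} \<union> C"
    let ?y = "\<Sum>x\<in>a ` {1..r}. c x *s x" and ?z = "\<Sum>x\<in>C. c x *s x"
    have yz: "?y + ?z = 0"
      using sum0 disj \<open>finite C\<close> by (simp add: sum.union_disjoint)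
    have "?y \<in> \<aa>" unfolding a(3)[symmetric] by (intro span_sum span_scale span_base)
    moreover have "?z \<in> range T" unfolding spC[symmetric] by (intro span_sum span_scale span_base)
    then have "?y \<in> range T"
      using yz R(1) subspace_neg[of "range T" ?z] by (simp add: eq_neg_iff_add_eq_0[symmetric])
    ultimately have "?y = 0" using R(2) by blast
    then have "?z = 0" using yz by simp
    show "c x = 0"
      using x independentD[OF a(2) _ subset_refl \<open>?y = 0\<close>]
        independentD[OF C(2) \<open>finite C\<close> subset_refl \<open>?z = 0\<close>] by auto
  qed
  obtain p where p: "Vector_Spaces.linear scale scale p"
      "\<And>x. x \<in> a ` {1..r} \<union> C \<Longrightarrow> p x = (if x \<in> C then inv T x else 0)"
    using gg.linear_independent_extend[OF ind, of "\<lambda>x. if x \<in> C then inv T x else 0"] by auto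
  interpret p: Vector_Spaces.linear scale scale p by fact
  have "\<exists>f. Vector_Spaces.linear scale (*) f \<and> (\<forall>x \<in> a ` {1..r} \<union> C. f x = (if x = a i then 1 else 0))" for i
    by (rule gF.linear_independent_extend[OF ind])
  then obtain f where f: "\<And>i. Vector_Spaces.linear scale (*) (f i)"
      "\<And>i x. x \<in> a ` {1..r} \<union> C \<Longrightarrow> f i x = (if x = a i then 1 else 0)"
    by metis
  have "\<exists>f. Vector_Spaces.linear scaleV (*) f \<and> (\<forall>x \<in> v ` {1..r}. f x = (if x = v i then 1 else 0))" for i
    by (rule vF.linear_independent_extend[OF v(2)])
  then obtain g where g: "\<And>i. Vector_Spaces.linear scaleV (*) (g i)"
      "\<And>i x. x \<in> v ` {1..r} \<Longrightarrow> g i x = (if x = v i then 1 else 0)"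
    by metis
  have f_simps: "f i (x + y) = f i x + f i y" "f i (c *s x) = c * f i x" "f i 0 = 0" for i x y c
    using f(1)[of i] by (auto simp: gF.linear_add gF.linear_scale gF.linear_0)
  have g_simps: "g i (x + y) = g i x + g i y" "g i (c *v x) = c * g i x" "g i 0 = 0" for i x y c
    using g(1)[of i] by (auto simp: vF.linear_add vF.linear_scale vF.linear_0)
  have Tp: "T (p (T x)) = T x" for x
  proof -
    have "T (p y) = y" if "y \<in> span C" for y
      using that
    proof (induction rule: span_induct_alt)
      case (step c x y)
      then have "T (p x) = x" using p(2)[of x] C(1) by (auto simp: f_inv_into_f)
      with step show ?case by (simp add: p.add p.scale linear_simps)
    qed (simp add: linear_simps)
    then show ?thesis using spC by auto
  qed
  have pa: "p x = 0" if "x \<in> \<aa>" for x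
  proof -
    have "x \<in> span (a ` {1..r})" using that a by simp
    then show ?thesis
    proof (induction rule: span_induct_alt)
      case (step c x y)
      then have "p x = 0" using p(2)[of x] disj by auto
      with step show ?case by (simp add: p.add p.scale)
    qed simp
  qed
  have fT: "f i (T x) = 0" if "i \<in> {1..r}" for i x
  proof -
    have "T x \<in> span C" using spC by auto
    then show ?thesis
    proof (induction rule: span_induct_alt)
      case (step c x y)
      moreover have "a i \<notin> C" using disj that by blast
      ultimately have "f i x = 0" using f(2)[of x i] by auto
      with step show ?case by (simp add: f_simps)
    qed (simp add: f_simps)
  qed
  have fa: "f i (a j) = (if j = i then 1 else 0)" if "i \<in> {1..r}" "j \<in> {1..r}" for i j
    using f(2)[of "a j" i] that a(1) by (auto simp: inj_on_eq_iff)
  have gv: "g i (v j) = (if j = i then 1 else 0)" if "i \<in> {1..r}" "j \<in> {1..r}" for i j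
    using g(2)[of "v j" i] that v(1) by (auto simp: inj_on_eq_iff)
  define \<beta> where "\<beta> X Y = B (T (p (fst X))) (p (fst Y)) +
    (\<Sum>i=1..r. f i (fst X) * g i (snd Y) + f i (fst Y) * g i (snd X))" for X Y
  have sym: "\<beta> X Y = \<beta> Y X" for X Y
    unfolding \<beta>_def using selfadjoint_T sym_B by (auto simp: add.commute intro!: arg_cong2[where f="(+)"] sum.cong)
  have lin: "Vector_Spaces.linear scaleG (*) (\<beta> X)" for X
  proof (rule Vector_Spaces.linear_iff[THEN iffD2], intro conjI allI vector_space_G vector_space_field)
    show "\<beta> X (Y + Z) = \<beta> X Y + \<beta> X Z" for Y Z
      unfolding \<beta>_def by (simp add: p.add linear_simps f_simps g_simps algebra_simps sum.distrib)
    show "\<beta> X (scaleG c Y) = c * \<beta> X Y" for c Y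
    proof -
      have "fst (scaleG c Y) = c *s fst Y" "snd (scaleG c Y) = c *v snd Y"
        by (cases Y, simp add: scaleG_Pair)+
      then show ?thesis
        unfolding \<beta>_def
        by (simp only: p.scale linear_simps f_simps g_simps distrib_left sum_distrib_left mult.assoc mult.left_commute[of _ c])
    qed
  qed
  have lin': "Vector_Spaces.linear scaleG (*) (\<lambda>X. \<beta> X Y)" for Y
    using lin[of Y] by (simp add: sym[of _ Y])
  have "is_formG \<beta>"
    unfolding is_formG_def bilinear_map_def
  proof (intro conjI allI ballI)
    show "\<beta> (T x, 0) (T y, 0) = B (T x) y" for x y
      by (simp add: \<beta>_def g_simps Tp) (metis Tp selfadjoint_T)
    show "\<beta> (x, u) (T y, 0) = 0" if "x \<in> \<aa>" for x u y
      using that by (simp add: \<beta>_def pa g_simps fT linear_simps)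
    show "\<beta> (x, 0) (y, 0) = 0" if "x \<in> \<aa>" for x y
      using that by (simp add: \<beta>_def pa g_simps linear_simps)
    show "\<beta> (0, u) (0, w) = 0" for u w
      by (simp add: \<beta>_def f_simps linear_simps)
    show "\<beta> (a i, 0) (0, v j) = (if i = j then 1 else 0)" if "i \<in> {1..r}" "j \<in> {1..r}" for i j
    proof -
      have "\<beta> (a i, 0) (0, v j) = (\<Sum>l=1..r. f l (a i) * g l (v j))"
        by (simp add: \<beta>_def f_simps linear_simps)
      also have "\<dots> = (\<Sum>l=1..r. if l = i then (if i = j then 1 else 0) else 0)"
        using that by (intro sum.cong) (auto simp: fa gv)
      finally show ?thesis using that by simp
    qed
  qed (use lin lin' sym in auto)
  then show ?thesis by blast
qed

lemma is_formG_unique: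
  assumes "is_formG \<beta>" "is_formG \<beta>'"
  shows "\<beta> = \<beta>'"
proof -
  interpret F: vector_space "(*) :: 'f \<Rightarrow> 'f \<Rightarrow> 'f" by (rule vector_space_field)
  interpret GF: vector_space_pair scaleG "(*) :: 'f \<Rightarrow> 'f \<Rightarrow> 'f"
    using vector_space_G vector_space_field by (simp add: vector_space_pair_def)
  define D where "D X Y = \<beta> X Y - \<beta>' X Y" for X Y
  have linD: "Vector_Spaces.linear scaleG (*) (D X)" for X
    using GF.linear_compose_sub[OF is_formG_linear(1)[OF assms(1)] is_formG_linear(1)[OF assms(2)]]
    by (simp add: D_def[abs_def])
  have sym: "D X Y = D Y X" for X Y
    unfolding D_def using assms is_formG_linear(3) by metis
  have addr: "D X (Y + Z) = D X Y + D X Z" and scaler: "D X (scaleG c Y) = c * D X Y"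
    and zeror: "D X 0 = 0" for X Y Z c
    using linD[of X] by (auto simp: GF.linear_add GF.linear_scale GF.linear_0)
  have addl: "D (X + Y) Z = D X Z + D Y Z" and scalel: "D (scaleG c X) Y = c * D X Y"
    and zerol: "D 0 Y = 0" for X Y Z c
    by (metis addr sym, metis scaler sym, metis zeror sym)
  have TT: "D (T x, 0) (T y, 0) = 0" and aT: "z \<in> \<aa> \<Longrightarrow> D (z, u) (T y, 0) = 0"
    and aa: "z \<in> \<aa> \<Longrightarrow> z' \<in> \<aa> \<Longrightarrow> D (z, 0) (z', 0) = 0" and VV: "D (0, u) (0, w) = 0"
    and av: "i \<in> {1..r} \<Longrightarrow> j \<in> {1..r} \<Longrightarrow> D (a i, 0) (0, v j) = 0" for x y z z' u w i j
    using assms by (auto simp: D_def is_formG_def)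
  have a: "span (a ` {1..r}) = \<aa>" and v: "V.span (v ` {1..r}) = UNIV"
    using basis_a basis_v by (auto simp: indexed_basis_def)
  have av1: "D (a i, 0) (0, w) = 0" if "i \<in> {1..r}" for i w
  proof -
    have "w \<in> V.span (v ` {1..r})" using v by simp
    then show ?thesis
    proof (induction rule: V.span_induct_alt)
      case (step c x y)
      then have "D (a i, 0) (0, x) = 0" using av that by auto
      then show ?case using step addr[of "(a i, 0)" "(0, c *v x)" "(0, y)"]
          scaler[of "(a i, 0)" c "(0, x)"] by (simp add: scaleG_Pair)
    qed (use zeror in \<open>simp add: zero_prod_def\<close>)
  qed
  have aV: "D (z, 0) (0, w) = 0" if "z \<in> \<aa>" for z w
  proof -
    have "z \<in> span (a ` {1..r})" using that a by simp
    then show ?thesis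
    proof (induction rule: span_induct_alt)
      case (step c x y)
      then have "D (x, 0) (0, w) = 0" using av1 by auto
      then show ?case using step addl[of "(c *s x, 0)" "(y, 0)" "(0, w)"]
          scalel[of c "(x, 0)" "(0, w)"] by (simp add: scaleG_Pair)
    qed (use zerol in \<open>simp add: zero_prod_def\<close>)
  qed
  have dec: "\<exists>z\<in>\<aa>. \<exists>y. x = z + T y" for x
    using complementary_a unfolding complementary_def by blast
  have "0 \<in> \<aa>" using a span_zero by blast
  have "D X Y = 0" for X Y
  proof -
    obtain z y u where X: "X = (z, 0) + (T y, 0) + (0, u)" "z \<in> \<aa>"
      using dec[of "fst X"] by (cases X) auto
    obtain z' y' u' where Y: "Y = (z', 0) + (T y', 0) + (0, u')" "z' \<in> \<aa>"
      using dec[of "fst Y"] by (cases Y) auto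
    show ?thesis
      unfolding X(1) Y(1) addl addr
      using X(2) Y(2) TT aT[OF X(2)] aT[OF Y(2)] aT[OF \<open>0 \<in> \<aa>\<close>] aa VV aV
        sym[of "(0, u)" "(z', 0)"] sym[of "(T y, 0)" "(z', 0)"] sym[of "(T y, 0)" "(0, u')"]
      by simp
  qed
  then show ?thesis by (intro ext) (simp add: D_def)
qed

lemma is_formG_BG: "is_formG BG"
  unfolding BG_def using is_formG_exists is_formG_unique by (metis theI)

definition muG :: "'g \<times> 'v \<Rightarrow> 'g \<times> 'v \<Rightarrow> 'g \<times> 'v" where
  "muG X Y = (\<mu> (fst X) (fst Y), 0)"

definition L :: "'g \<times> 'v \<Rightarrow> 'g \<times> 'v" where
  "L X = k (fst X)"

definition h :: "'g \<times> 'v \<Rightarrow> 'g" where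
  "h = (THE f. Vector_Spaces.linear scaleG scale f \<and> (\<forall>X y. B (f X) y = BG X (y, 0)))"

lemma ex1_h:
  "\<exists>!f. Vector_Spaces.linear scaleG scale f \<and> (\<forall>X y. B (f X) y = BG X (y, 0))"
proof -
  obtain E where E: "finite_dimensional_vector_space scale E" using finite_dim by blast
  interpret E: finite_dimensional_vector_space scale E by fact
  have BG_add: "BG (X + Y) Z = BG X Z + BG Y Z" "BG Z (X + Y) = BG Z X + BG Z Y"
    "BG (scaleG c X) Z = c * BG X Z" "BG Z (scaleG c X) = c * BG Z X" "BG Z 0 = 0" for X Y Z c
  proof -
    have "Vector_Spaces.linear scaleG (*) (BG Z)" "Vector_Spaces.linear scaleG (*) (\<lambda>X. BG X Z)"
      using is_formG_BG by (auto intro: is_formG_linear)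
    then interpret l1: Vector_Spaces.linear scaleG "(*)" "BG Z" + l2: Vector_Spaces.linear scaleG "(*)" "\<lambda>X. BG X Z"
      by auto
    show "BG (X + Y) Z = BG X Z + BG Y Z" "BG Z (X + Y) = BG Z X + BG Z Y"
    "BG (scaleG c X) Z = c * BG X Z" "BG Z (scaleG c X) = c * BG Z X" "BG Z 0 = 0"
      using l1.add l1.scale l2.add l2.scale l1.zero by auto
  qed
  have uniq: "x = y" if "\<And>z. B x z = B y z" for x y
  proof -
    have "B (x - y) z = 0" for z
      using linear_simps(4)[of "x - y" y z] that[of z] by simp
    then show ?thesis using nondegenerate_B[of "x - y"] by auto
  qed
  define \<phi> where "\<phi> x = (\<Sum>e\<in>E. B x e *s e)" for x
  have coef: "\<forall>e\<in>E. c e = d e" if "(\<Sum>e\<in>E. c e *s e) = (\<Sum>e\<in>E. d e *s e)" for c d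
  proof -
    have "(\<Sum>e\<in>E. (c e - d e) *s e) = 0"
      using that by (simp add: scale_left_diff_distrib sum_subtractf)
    then show ?thesis
      using E.independent_Basis E.finite_Basis independentD[of E E "\<lambda>e. c e - d e"] by auto
  qed
  have ext: "B x z = g z" if g: "\<forall>e\<in>E. B x e = g e" "\<And>y z. g (y + z) = g y + g z" "\<And>c z. g (c *s z) = c * g z"
    for x g z
  proof -
    have g0: "g 0 = 0" using g(3)[of 0 0] by simp
    have "z \<in> span E" using E.span_Basis by simp
    then show ?thesis
      by (induction rule: span_induct_alt) (use g g0 in \<open>auto simp: linear_simps\<close>)
  qed
  have lin\<phi>: "Vector_Spaces.linear scale scale \<phi>"
    by (rule Vector_Spaces.linear_iff[THEN iffD2])
      (use vector_space_axioms in \<open>auto simp: \<phi>_def linear_simps scale_left_distrib sum.distrib scale_sum_right\<close>)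
  have "inj \<phi>"
  proof (rule injI)
    fix x y assume "\<phi> x = \<phi> y"
    then have "\<forall>e\<in>E. B x e = B y e" using coef unfolding \<phi>_def by blast
    then have "B x z = B y z" for z by (rule ext[where g = "B y"]) (auto simp: linear_simps)
    then show "x = y" by (rule uniq)
  qed
  then have "surj \<phi>" using E.linear_inj_imp_surj[OF lin\<phi>] by blast
  have "\<exists>x. \<forall>y. B x y = BG X (y, 0)" for X
  proof -
    obtain x where "\<phi> x = (\<Sum>e\<in>E. BG X (e, 0) *s e)" using \<open>surj \<phi>\<close> by (metis surjD)
    then have "\<forall>e\<in>E. B x e = BG X (e, 0)"
      using coef[of "B x" "\<lambda>e. BG X (e, 0)"] unfolding \<phi>_def by blast
    then have "B x y = BG X (y, 0)" for y
      by (rule ext[where g = "\<lambda>y. BG X (y, 0)"])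
        (use BG_add(2)[of X "(_, 0)" "(_, 0)"] BG_add(4)[of X _ "(_, 0)"] in \<open>auto simp: scaleG_Pair\<close>)
    then show ?thesis by blast
  qed
  then obtain f where f: "\<And>X y. B (f X) y = BG X (y, 0)" by metis
  have "f (X + Y) = f X + f Y" "f (scaleG c X) = c *s f X" for X Y c
    by (rule uniq, simp only: f linear_simps BG_add)+
  then have "Vector_Spaces.linear scaleG scale f"
    using vector_space_axioms vector_space_G unfolding Vector_Spaces.linear_iff by blast
  moreover have "f' = f" if "\<forall>X y. B (f' X) y = BG X (y, 0)" for f'
    by (rule HOL.ext, rule uniq) (use that f in metis)
  ultimately show ?thesis using f by blast
qed

definition prodG :: "'g \<times> 'v \<Rightarrow> 'g \<times> 'v \<Rightarrow> 'g \<times> 'v" where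
  "prodG X Y = scaleG (1/2) (muG X Y - bracketG (h X, 0) Y + bracketG X (h Y, 0))"

abbreviation scaleA :: "'f \<Rightarrow> 'f \<times> 'g \<times> 'v \<Rightarrow> 'f \<times> 'g \<times> 'v" where
  "scaleA \<equiv> module_prod.scale (*) scaleG"

definition multA :: "'f \<times> 'g \<times> 'v \<Rightarrow> 'f \<times> 'g \<times> 'v \<Rightarrow> 'f \<times> 'g \<times> 'v" where
  "multA p q = (case (p, q) of ((\<xi>, X), (\<eta>, Y)) \<Rightarrow>
     (\<xi> * \<eta> + BG X Y, scaleG \<xi> Y + scaleG \<eta> X + prodG X Y))"

end


section \<open>The quotient by the line spanned by the unit\<close>

text \<open>
  In a product of the base field with another space, the multiples of \<open>(1, 0)\<close> are exactly the
  pairs \<open>(c, 0)\<close>.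
\<close>

lemma unit_line_iff: "p \<in> range (\<lambda>c. (c, 0)) \<longleftrightarrow> snd p = 0"
  by (cases p) auto

quotient_type (overloaded) ('f, 'a) mod_unit = "'f::ab_group_add \<times> 'a::ab_group_add" /
  "\<lambda>p q. p - q \<in> range (\<lambda>c. (c, 0))"
  morphisms rep_mod_unit unit_class
  by (auto simp: unit_line_iff intro!: equivpI reflpI sympI transpI)

instantiation mod_unit :: (ab_group_add, ab_group_add) ab_group_add
begin

lift_definition zero_mod_unit :: "('a, 'b) mod_unit" is 0 .

lift_definition plus_mod_unit :: "('a, 'b) mod_unit \<Rightarrow> ('a, 'b) mod_unit \<Rightarrow> ('a, 'b) mod_unit" is "(+)"
  by (simp only: unit_line_iff) simp

lift_definition minus_mod_unit :: "('a, 'b) mod_unit \<Rightarrow> ('a, 'b) mod_unit \<Rightarrow> ('a, 'b) mod_unit" is "(-)"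
  by (simp only: unit_line_iff) simp

lift_definition uminus_mod_unit :: "('a, 'b) mod_unit \<Rightarrow> ('a, 'b) mod_unit" is uminus
  by (simp only: unit_line_iff) simp

instance
  by standard (transfer, simp add: unit_line_iff)+

end

definition scale_mod_unit ::
  "('f::field \<Rightarrow> 'a::ab_group_add \<Rightarrow> 'a) \<Rightarrow> 'f \<Rightarrow> ('f, 'a) mod_unit \<Rightarrow> ('f, 'a) mod_unit" where
  "scale_mod_unit s c P = unit_class (module_prod.scale (*) s c (rep_mod_unit P))"

lemma scale_mod_unit_class:
  fixes s :: "'f::field \<Rightarrow> 'a::ab_group_add \<Rightarrow> 'a"
  assumes "vector_space s"
  shows "scale_mod_unit s c (unit_class p) = unit_class (module_prod.scale (*) s c p)"
proof -
  interpret vector_space s by fact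
  interpret vector_space_prod "(*)" s
    by unfold_locales (auto simp: algebra_simps)
  have "rep_mod_unit (unit_class p) - p \<in> range (\<lambda>c. (c, 0))"
    using Quotient3_rep_abs[OF Quotient3_mod_unit, of p] by (simp add: unit_line_iff)
  then obtain d where "rep_mod_unit (unit_class p) - p = (d, 0)" by auto
  then have "rep_mod_unit (unit_class p) = p + (d, 0)" by (simp add: algebra_simps)
  then have "module_prod.scale (*) s c (rep_mod_unit (unit_class p)) - module_prod.scale (*) s c p = (c * d, 0)"
    by (simp add: scale_def algebra_simps)
  then show ?thesis
    unfolding scale_mod_unit_def by (auto simp: mod_unit.abs_eq_iff)
qed

lemma span_unit_eq:
  fixes s :: "'f::field \<Rightarrow> 'a::ab_group_add \<Rightarrow> 'a"
  assumes "vector_space s"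
  shows "module.span (module_prod.scale (*) s) {(1, 0)} = range (\<lambda>c. (c, 0))"
proof -
  interpret vector_space s by fact
  interpret vector_space_prod "(*)" s
    by unfold_locales (auto simp: algebra_simps)
  show ?thesis by (simp add: p.span_singleton scale_def)
qed

end

theory Submission
  imports Defs
begin

text \<open>
  Every \<open>u\<close> in \<open>V\<close> satisfies \<open>h u \<in> Ker T\<close>, so that \<open>u X = X u \<in> V\<close> for all \<open>X\<close> in \<open>\<GG>\<close>, and
  \<open>u X = 0\<close> as soon as \<open>X\<close> is orthogonal to \<open>V\<close>, because the first component of such an \<open>X\<close> lies
  in \<open>Im T\<close> and \<open>\<mu> (h u) (T y) = \<mu> (T (h u)) y = 0\<close>.  A non-zero one-sided ideal contains some
  \<open>(1, X)\<close> because the form is non-degenerate.  If it met the span of the unit and \<open>V\<close> in zero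
  only, then \<open>(0, u) (1, X) = (B(u, X), u + u X)\<close> would vanish for all \<open>u\<close> in \<open>V\<close>; so \<open>X\<close> would be
  orthogonal to \<open>V\<close> and \<open>u = 0\<close>, contradicting \<open>r > 0\<close>.  Hence it contains a non-zero \<open>(\<xi>, u)\<close>,
  and then the unit, since \<open>(1, u) (1, -u) = (1, 0)\<close>.  Associativity fails because
  \<open>(u u) Z = 0\<close> while \<open>u (u Z) = B(u, Z) u\<close>.
\<close>

section \<open>Finite dimension of products and images, coordinates in a basis\<close>

lemma finite_dimensional_prod:
  assumes "finite_dimensional_vector_space s1 B1" "finite_dimensional_vector_space s2 B2"
  shows "\<exists>E. finite_dimensional_vector_space (module_prod.scale s1 s2) E"
proof -
  interpret A: finite_dimensional_vector_space s1 B1 by fact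
  interpret B: finite_dimensional_vector_space s2 B2 by fact
  interpret finite_dimensional_vector_space_prod s1 s2 B1 B2 by unfold_locales
  show ?thesis using p.finite_dimensional_vector_space_axioms by blast
qed

text \<open>The image of a basis spans the target, and a basis is extracted from it. This serves the
  quotient by the unit line.\<close>

lemma finite_dimensional_linear_image:
  assumes "finite_dimensional_vector_space s1 E" "Vector_Spaces.linear s1 s2 f" "surj f"
  shows "\<exists>E'. finite_dimensional_vector_space s2 E'"
proof -
  interpret E: finite_dimensional_vector_space s1 E by fact
  interpret f: Vector_Spaces.linear s1 s2 f by fact
  have span: "f.vs2.span (f ` E) = UNIV"
    using f.span_image[of E] E.span_Basis \<open>surj f\<close> by simp
  obtain C where C: "C \<subseteq> f ` E" "f.vs2.independent C" "f ` E \<subseteq> f.vs2.span C"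
    by (rule f.vs2.basis_exists[of "f ` E"])
  have "finite C" using C(1) E.finite_Basis finite_surj by blast
  moreover have "f.vs2.span C = UNIV"
    using f.vs2.span_minimal[OF C(3) f.vs2.subspace_span] span by auto
  ultimately have "finite_dimensional_vector_space s2 C"
    using C(2) by unfold_locales
  then show ?thesis by blast
qed

lemma sum_indexed_basis:
  assumes "vector_space s" "indexed_basis s n b S" "x \<in> S"
  shows "\<exists>c. x = (\<Sum>i=1..n. s (c i) (b i))"
proof -
  interpret vector_space s by fact
  have "x \<in> span (b ` {1..n})" "inj_on b {1..n}"
    using assms by (auto simp: indexed_basis_def)
  then show ?thesis
    by (auto simp: span_finite sum.reindex)
qed

lemma unit_class_eq_iff: "unit_class p = unit_class q \<longleftrightarrow> snd p = snd q"
  by (simp add: mod_unit.abs_eq_iff unit_line_iff)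

context hom_lie_extension
begin

section \<open>Linearity of the maps of the construction, values of the form\<close>

lemma mu_simps:
  "\<mu> (x + y) z = \<mu> x z + \<mu> y z" "\<mu> (c *s x) z = c *s \<mu> x z" "\<mu> 0 z = 0"
  "\<mu> z (x + y) = \<mu> z x + \<mu> z y" "\<mu> z (c *s x) = c *s \<mu> z x" "\<mu> z 0 = 0"
proof -
  interpret l: Vector_Spaces.linear scale scale "\<lambda>x. \<mu> x z"
    using bilinear_mu by (simp add: bilinear_map_def)
  interpret r: Vector_Spaces.linear scale scale "\<mu> z"
    using bilinear_mu by (simp add: bilinear_map_def)
  show "\<mu> (x + y) z = \<mu> x z + \<mu> y z" "\<mu> (c *s x) z = c *s \<mu> x z" "\<mu> 0 z = 0"
    "\<mu> z (x + y) = \<mu> z x + \<mu> z y" "\<mu> z (c *s x) = c *s \<mu> z x" "\<mu> z 0 = 0"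
    by (rule l.add l.scale l.zero r.add r.scale r.zero)+
qed

lemma T_mu: "T (\<mu> x y) = \<mu> (T x) y" "T (\<mu> x y) = \<mu> x (T y)"
proof -
  interpret T: Vector_Spaces.linear scale scale T by (rule linear_T)
  show 1: "T (\<mu> x y) = \<mu> (T x) y" for x y
    using centroid_T by (simp add: centroid_def)
  show "T (\<mu> x y) = \<mu> x (T y)"
    using 1[of y x] skew_mu[of x y] skew_mu[of x "T y"] by (simp add: T.neg)
qed

lemma BG_simps:
  "BG (X + Y) Z = BG X Z + BG Y Z" "BG (scaleG c X) Z = c * BG X Z" "BG 0 Z = 0"
  "BG Z (X + Y) = BG Z X + BG Z Y" "BG Z (scaleG c X) = c * BG Z X" "BG Z 0 = 0"
proof -
  interpret l: Vector_Spaces.linear scaleG "(*)" "\<lambda>X. BG X Z"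
    by (rule is_formG_linear[OF is_formG_BG])
  interpret r: Vector_Spaces.linear scaleG "(*)" "BG Z"
    by (rule is_formG_linear[OF is_formG_BG])
  show "BG (X + Y) Z = BG X Z + BG Y Z" "BG (scaleG c X) Z = c * BG X Z" "BG 0 Z = 0"
    "BG Z (X + Y) = BG Z X + BG Z Y" "BG Z (scaleG c X) = c * BG Z X" "BG Z 0 = 0"
    by (rule l.add l.scale l.zero r.add r.scale r.zero)+
qed

lemma BG_sym: "BG X Y = BG Y X"
  by (rule is_formG_linear[OF is_formG_BG])

text \<open>Gives access to the case \<open>z = 0\<close> of \<open>BG_values\<close>, in which V is
  orthogonal to Im T.\<close>

lemma zero_in_a: "0 \<in> \<aa>"
  using basis_a span_zero by (auto simp: indexed_basis_def)

lemma BG_values: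
  "BG (T x, 0) (T y, 0) = B (T x) y"
  "z \<in> \<aa> \<Longrightarrow> BG (z, u) (T y, 0) = 0"
  "BG (0, u) (0, w) = 0"
  "i \<in> {1..r} \<Longrightarrow> j \<in> {1..r} \<Longrightarrow> BG (a i, 0) (0, v j) = (if i = j then 1 else 0)"
  using is_formG_BG by (auto simp: is_formG_def)

lemma BG_V_T: "BG (0, u) (T y, 0) = 0"
  by (rule BG_values(2)[OF zero_in_a])

lemma k_simps: "k (x + y) = k x + k y" "k (c *s x) = scaleG c (k x)"
  by (simp_all add: k_def linear_simps scaleG_Pair V.scale_left_distrib sum.distrib V.scale_sum_right)

lemma k_zero: "k 0 = 0"
  using k_simps(1)[of 0 0] by simp

lemma k_minus: "k (- x) = - k x"
  using k_simps(1)[of x "- x"] by (simp add: k_zero eq_neg_iff_add_eq_0 add.commute)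

lemma h_simps: "h (X + Y) = h X + h Y" "h (scaleG c X) = c *s h X" "B (h X) y = BG X (y, 0)"
proof -
  have *: "Vector_Spaces.linear scaleG scale h \<and> (\<forall>X y. B (h X) y = BG X (y, 0))"
    unfolding h_def by (rule theI'[OF ex1_h])
  then interpret h: Vector_Spaces.linear scaleG scale h by blast
  show "h (X + Y) = h X + h Y" "h (scaleG c X) = c *s h X" by (rule h.add h.scale)+
  show "B (h X) y = BG X (y, 0)" using * by blast
qed

text \<open>\<open>T\<close> is self-adjoint, so \<open>B (T (h (0, u))) y\<close> equals
  \<open>BG (0, u) (T y, 0)\<close>, and V is orthogonal to Im T.\<close>

lemma T_h_V: "T (h (0, u)) = 0"
  by (rule nondegenerate_B) (simp add: selfadjoint_T h_simps BG_V_T)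

section \<open>Orthogonality to V and non-degeneracy of \<open>BG\<close>\<close>

lemma BG_sum_left: "finite N \<Longrightarrow> BG (\<Sum>i\<in>N. f i) Y = (\<Sum>i\<in>N. BG (f i) Y)"
  by (induction rule: finite_induct) (simp_all add: BG_simps)

lemma BG_a_sum:
  assumes "j \<in> {1..r}"
  shows "BG (\<Sum>i=1..r. c i *s a i, 0) (0, v j) = c j"
proof -
  have "(\<Sum>i=1..r. c i *s a i, 0) = (\<Sum>i=1..r. scaleG (c i) (a i, 0))"
    by (simp add: scaleG_Pair sum_prod)
  then show ?thesis
    using assms by (simp add: BG_sum_left BG_simps BG_values if_distrib cong: if_cong)
qed

lemma BG_v_sum:
  assumes "j \<in> {1..r}"
  shows "BG (0, \<Sum>i=1..r. c i *v v i) (a j, 0) = c j"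
proof -
  have "(0, \<Sum>i=1..r. c i *v v i) = (\<Sum>i=1..r. scaleG (c i) (0, v i))"
    by (simp add: scaleG_Pair sum_prod)
  then show ?thesis
    using assms
    by (simp add: BG_sum_left BG_simps BG_sym[of "(0, v _)"] BG_values if_distrib cong: if_cong)
qed

text \<open>Split \<open>fst X\<close> along \<open>\<aa>\<close> and Im T. Pairing with
  \<open>v j\<close> reads off the j-th coordinate of the part in \<open>\<aa>\<close>, so this part
  vanishes.\<close>

lemma fst_in_range_T:
  assumes "\<And>u. BG X (0, u) = 0"
  shows "fst X \<in> range T"
proof -
  obtain z y where zy: "z \<in> \<aa>" "fst X = z + T y"
    using complementary_a unfolding complementary_def by blast
  obtain c where c: "z = (\<Sum>i=1..r. c i *s a i)"
    using sum_indexed_basis[OF vector_space_axioms basis_a zy(1)] by blast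
  have X: "X = (z, 0) + (T y, 0) + (0, snd X)"
    using zy(2) by (cases X) simp
  have "BG (z, 0) (0, v j) = 0" for j
    using assms[of "v j"]
    by (subst (asm) X) (simp add: BG_simps BG_values BG_V_T BG_sym[of "(T y, 0)"] del: add_Pair)
  then have "c j = 0" if "j \<in> {1..r}" for j
    using BG_a_sum[OF that, of c] c by simp
  then have "z = 0" by (simp add: c)
  then show ?thesis using zy(2) by simp
qed

text \<open>The family \<open>a\<close> is dual to \<open>v\<close>, so pairing with
  \<open>a j\<close> detects a non-zero j-th coordinate of \<open>u\<close>.\<close>

lemma BG_V_nondegenerate:
  assumes "u \<noteq> 0"
  shows "\<exists>z. BG (0, u) (z, 0) \<noteq> 0"
proof -
  obtain c where c: "u = (\<Sum>i=1..r. c i *v v i)"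
    using sum_indexed_basis[OF V.vector_space_axioms basis_v] by blast
  have "\<exists>j\<in>{1..r}. c j \<noteq> 0"
    by (rule ccontr) (use assms in \<open>simp add: c\<close>)
  then obtain j where "j \<in> {1..r}" "c j \<noteq> 0" by blast
  then show ?thesis using BG_v_sum[of j c] c by metis
qed

text \<open>Pairing with V forces \<open>fst X = T y\<close>; pairing with Im T then gives
  \<open>T y = 0\<close>, because \<open>B\<close> is non-degenerate; pairing with \<gg> kills what
  is left in V.\<close>

lemma BG_nondegenerate:
  assumes "\<And>Y. BG X Y = 0"
  shows "X = 0"
proof -
  obtain y where y: "fst X = T y" using fst_in_range_T assms by blast
  have X: "X = (T y, 0) + (0, snd X)" using y by (cases X) simp
  have "B (T y) x = 0" for x
    using assms[of "(T x, 0)"] by (subst (asm) X) (simp add: BG_simps BG_values BG_V_T del: add_Pair)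
  then have "T y = 0" by (rule nondegenerate_B)
  then have "X = (0, snd X)" using X by simp
  then have "snd X = 0" using BG_V_nondegenerate assms by metis
  with \<open>X = (0, snd X)\<close> show ?thesis by (simp add: zero_prod_def)
qed

text \<open>The assumption \<open>r_pos\<close> enters here. A non-zero \<open>u\<close> drives both
  the failure of associativity and the argument on ideals.\<close>

lemma ex_V_nonzero: "\<exists>u::'v. u \<noteq> 0"
proof -
  have "v 1 \<in> v ` {1..r}" using r_pos by auto
  then have "v 1 \<noteq> 0"
    using basis_v V.dependent_zero unfolding indexed_basis_def by metis
  then show ?thesis by blast
qed

section \<open>The product on \<GG> and its behaviour on V\<close>

interpretation G: vector_space scaleG
  by (rule vector_space_G)

lemma fst_scaleG: "fst (scaleG c X) = c *s fst X"
  by (cases X) (simp add: scaleG_Pair)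

lemma prodG_eq:
  "prodG X Y = scaleG (1/2) ((\<mu> (fst X) (fst Y), 0) - k (\<mu> (h X) (fst Y)) + k (\<mu> (fst X) (h Y)))"
  by (simp add: prodG_def muG_def bracketG_def)

lemma prodG_simps:
  "prodG (X + Y) Z = prodG X Z + prodG Y Z" "prodG (scaleG c X) Z = scaleG c (prodG X Z)"
  "prodG Z (X + Y) = prodG Z X + prodG Z Y" "prodG Z (scaleG c X) = scaleG c (prodG Z X)"
proof -
  \<comment> \<open>Splits such pairs so that they match the shape of the \<open>k\<close> terms;
    \<open>add_Pair\<close> would undo this.\<close>
  have add0: "(x + y, 0 :: 'v) = (x, 0) + (y, 0)" for x y :: 'g by simp
  have scale0: "(c *s x, 0 :: 'v) = scaleG c (x, 0)" for x by (simp add: scaleG_Pair)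
  show "prodG (X + Y) Z = prodG X Z + prodG Y Z" "prodG Z (X + Y) = prodG Z X + prodG Z Y"
    by (simp_all add: prodG_eq h_simps mu_simps k_simps add0 G.scale_right_distrib
        G.scale_right_diff_distrib del: add_Pair)
  show "prodG (scaleG c X) Z = scaleG c (prodG X Z)" "prodG Z (scaleG c X) = scaleG c (prodG Z X)"
    by (simp_all add: prodG_eq h_simps mu_simps k_simps fst_scaleG scale0 G.scale_right_distrib
        G.scale_right_diff_distrib mult.commute)
qed

lemma prodG_zero: "prodG 0 X = 0" "prodG X 0 = 0"
  using prodG_simps(1)[of 0 0 X] prodG_simps(3)[of X 0 0] by simp_all

text \<open>As \<open>\<mu>\<close> is skew, the two bracket terms together are symmetric in
  \<open>X\<close> and \<open>Y\<close> and cancel; the \<open>\<mu>\<close> term doubles and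
  absorbs the factor 1/2.\<close>

lemma prodG_commutator: "prodG X Y - prodG Y X = muG X Y"
proof -
  have "prodG X Y - prodG Y X = scaleG (1/2) (scaleG 2 (\<mu> (fst X) (fst Y), 0))"
    unfolding prodG_eq skew_mu[of "fst Y" "fst X"] skew_mu[of "h Y"] skew_mu[of "fst Y" "h X"] k_minus
    by (simp add: G.scale_right_diff_distrib[symmetric] scaleG_Pair algebra_simps
        scale_left_distrib[symmetric] flip: scale_right_diff_distrib)
  then show ?thesis by (simp add: muG_def)
qed

text \<open>All terms containing \<open>fst (0, u) = 0\<close> vanish. The one that is left is the
  same in both orders by skew-symmetry, so V commutes with everything.\<close>

lemma prodG_V:
  "prodG (0, u) X = scaleG (1/2) (k (\<mu> (fst X) (h (0, u))))"
  "prodG X (0, u) = scaleG (1/2) (k (\<mu> (fst X) (h (0, u))))"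
  unfolding prodG_eq skew_mu[of "h (0, u)"] by (simp_all add: mu_simps k_zero k_minus flip: zero_prod_def)

text \<open>The first component of \<open>k\<close> is \<open>T\<close>, and the centroid property
  moves \<open>T\<close> onto \<open>h (0, u)\<close>, which it annihilates.\<close>

lemma prodG_V_in_V: "fst (prodG (0, u) X) = 0"
  by (simp add: prodG_V fst_scaleG k_def T_mu(2) T_h_V mu_simps)

lemma prodG_V_eq_0:
  assumes "fst X \<in> range T"
  shows "prodG (0, u) X = 0"
  using assms by (auto simp: prodG_V T_mu(1)[symmetric] T_mu(2) T_h_V mu_simps k_zero)

section \<open>The algebra on F x \<GG>: unit, commutators, failure of associativity\<close>

lemma scaleA_Pair: "scaleA c (\<xi>, X) = (c * \<xi>, scaleG c X)"
proof -
  interpret vector_space_prod "(*) :: 'f \<Rightarrow> 'f \<Rightarrow> 'f" scaleG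
    by (intro vector_space_prod.intro vector_space_pair.intro vector_space_field vector_space_G)
  show ?thesis by (simp add: scale_prod)
qed

lemma multA_Pair: "multA (\<xi>, X) (\<eta>, Y) = (\<xi> * \<eta> + BG X Y, scaleG \<xi> Y + scaleG \<eta> X + prodG X Y)"
  by (simp add: multA_def)

lemma finite_dimensional_G: "\<exists>E. finite_dimensional_vector_space scaleG E"
  using finite_dim V.finite_dim finite_dimensional_prod by blast

lemma finite_dimensional_A: "\<exists>E. finite_dimensional_vector_space scaleA E"
proof -
  interpret F: vector_space "(*) :: 'f \<Rightarrow> 'f \<Rightarrow> 'f" by (rule vector_space_field)
  have "finite_dimensional_vector_space ((*) :: 'f \<Rightarrow> 'f \<Rightarrow> 'f) {1}"
    by unfold_locales (auto simp: F.span_singleton)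
  then show ?thesis using finite_dimensional_G finite_dimensional_prod by blast
qed

lemma vector_space_A: "vector_space scaleA"
  using finite_dimensional_A finite_dimensional_vector_space.axioms(1) by blast

lemma scaleA_eq: "scaleA c p = (c * fst p, scaleG c (snd p))"
  using scaleA_Pair[of c "fst p" "snd p"] by simp

lemma multA_eq:
  "multA p q = (fst p * fst q + BG (snd p) (snd q),
    scaleG (fst p) (snd q) + scaleG (fst q) (snd p) + prodG (snd p) (snd q))"
  using multA_Pair[of "fst p" "snd p" "fst q" "snd q"] by simp

lemma multA_linear:
  "Vector_Spaces.linear scaleA scaleA (multA p)" "Vector_Spaces.linear scaleA scaleA (\<lambda>q. multA q p)"
proof -
  have "multA p (q + q') = multA p q + multA p q'" "multA (q + q') p = multA q p + multA q' p"
    "multA p (scaleA c q) = scaleA c (multA p q)" "multA (scaleA c q) p = scaleA c (multA q p)"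
    for q q' c
    by (simp_all add: multA_eq scaleA_eq BG_simps prodG_simps G.scale_right_distrib
        G.scale_left_distrib distrib_left distrib_right ac_simps)
  then show "Vector_Spaces.linear scaleA scaleA (multA p)"
    "Vector_Spaces.linear scaleA scaleA (\<lambda>q. multA q p)"
    using vector_space_A unfolding Vector_Spaces.linear_iff by blast+
qed

lemma multA_one: "multA (1, 0) p = p" "multA p (1, 0) = p"
  by (cases p; simp add: multA_Pair BG_simps prodG_zero)+

lemma unital_algebra_A: "unital_algebra scaleA multA (1, 0)"
  using vector_space_A finite_dimensional_A multA_linear
  by (simp add: unital_algebra_def fd_vector_space_def fd_vector_space_axioms_def
      unital_algebra_axioms_def bilinear_map_def multA_one)

text \<open>The scalar parts agree because \<open>BG\<close> is symmetric, and the mixed terms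
  cancel, so only the commutator of \<open>prodG\<close> remains.\<close>

lemma multA_commutator: "multA (\<xi>, X) (\<eta>, Y) - multA (\<eta>, Y) (\<xi>, X) = (0, muG X Y)"
  by (simp add: multA_Pair prodG_commutator[symmetric] BG_sym[of Y X])

text \<open>By \<open>multA_commutator\<close> the commutators are the values of \<open>muG\<close>;
  for \<open>\<mu> = 0\<close> the algebra would be commutative.\<close>

lemma multA_noncommutative:
  assumes "\<mu> x y \<noteq> 0"
  shows "\<exists>p q. multA p q \<noteq> multA q p"
proof -
  have "multA (0, (x, 0)) (0, (y, 0)) - multA (0, (y, 0)) (0, (x, 0)) \<noteq> 0"
    using assms by (simp add: multA_commutator muG_def zero_prod_def)
  then show ?thesis by (metis right_minus_eq)
qed

text \<open>Allows a product with an element of F x V to be taken on either side, so that one-sided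
  ideals behave there like two-sided ones.\<close>

lemma multA_V_commute: "multA (\<xi>, (0, u)) p = multA p (\<xi>, (0, u))"
  by (cases p) (simp add: multA_Pair prodG_V BG_sym[of "(0, u)"] algebra_simps)

lemma multA_nonassociative: "\<exists>p q s. multA (multA p q) s \<noteq> multA p (multA q s)"
proof -
  obtain u :: 'v and z where u: "u \<noteq> 0" and z: "BG (0, u) (z, 0) \<noteq> 0"
    using ex_V_nonzero BG_V_nondegenerate by blast
  let ?p = "(0, (0, u)) :: 'f \<times> 'g \<times> 'v" and ?s = "(0, (z, 0)) :: 'f \<times> 'g \<times> 'v"
  \<comment> \<open>The first component of \<open>(0, w)\<close> is \<open>0 = T 0\<close>.\<close>
  have VV: "prodG (0, u) (0, w) = 0" for w
    by (rule prodG_V_eq_0) (metis fst_conv linear_simps(3) rangeI)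
  have "multA ?p ?p = (0, 0)"
    by (simp add: multA_Pair VV BG_values)
  then have "multA (multA ?p ?p) ?s = (0, 0)"
    by (simp add: multA_Pair BG_simps prodG_zero)
  \<comment> \<open>The product of \<open>u\<close> and \<open>z\<close> is a scalar plus some
    \<open>w\<close> in V. As V times V is zero, a second multiplication by \<open>u\<close> leaves
    only the scalar times \<open>u\<close>.\<close>
  moreover obtain w where w: "prodG (0, u) (z, 0) = (0, w)"
    using prodG_V_in_V[of u "(z, 0)"] by (metis prod.collapse)
  have "multA ?p (multA ?p ?s) = (0, scaleG (BG (0, u) (z, 0)) (0, u))"
    by (simp add: multA_Pair w VV BG_values BG_simps)
  moreover have "\<dots> \<noteq> (0, 0)" using u z by (simp add: zero_prod_def scaleG_Pair)
  ultimately show ?thesis by metis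
qed

section \<open>One-sided ideals\<close>

text \<open>The disjunction in \<open>mult\<close> treats left and right ideals at once. It suffices
  because each step either multiplies by an element of F x V, which commutes with everything, or
  uses only the scalar part of a product, which does not depend on the side since \<open>BG\<close>
  is symmetric.\<close>

lemma one_sided_ideal_trivial:
  assumes I: "module.subspace scaleA I"
    and mult: "\<And>p q. p \<in> I \<Longrightarrow> multA p q \<in> I \<or> multA q p \<in> I"
    and "I \<noteq> {0}"
  shows "I = UNIV"
proof -
  interpret A: vector_space scaleA by (rule vector_space_A)
  have scale: "scaleA c p \<in> I" if "p \<in> I" for c p
    using A.subspace_scale[OF I that] .
  have normalize: "(1, scaleG (inverse \<xi>) Y) \<in> I" if "(\<xi>, Y) \<in> I" "\<xi> \<noteq> 0" for \<xi> Y
    using scale[OF that(1), of "inverse \<xi>"] that(2) by (simp add: scaleA_Pair)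
  have V_mult: "multA (\<xi>, (0, u)) p \<in> I" if "p \<in> I \<or> (\<xi>, (0, u)) \<in> I" for \<xi> u p
    using that mult multA_V_commute by metis
  have unitV: "I = UNIV" if "(1, (0, u)) \<in> I" for u
  proof -
    have "multA (1, (0, - u)) (1, (0, u)) \<in> I" using V_mult that by blast
    moreover have "prodG (0, - u) (0, u) = 0"
      by (rule prodG_V_eq_0) (metis fst_conv linear_simps(3) rangeI)
    ultimately have "(1, 0) \<in> I"
      by (simp add: multA_Pair BG_values zero_prod_def)
    then have "p \<in> I" for p using mult[of "(1, 0)" p] by (simp add: multA_one)
    then show ?thesis by blast
  qed
  have V_scalar: "I = UNIV" if "(\<xi>, (0, u)) \<in> I" "\<xi> \<noteq> 0" for \<xi> u
    using normalize[OF that] unitV by (auto simp: scaleG_Pair)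
  have V_nonzero: "I = UNIV" if \<xi>u: "(\<xi>, (0, u)) \<in> I" "(\<xi>, u) \<noteq> 0" for \<xi> u
  proof (cases "\<xi> = 0")
    case True
    \<comment> \<open>For \<open>\<xi> = 0\<close>, multiplying by a vector not orthogonal to
      \<open>u\<close> makes the scalar part non-zero and stays in F x V.\<close>
    then obtain z where z: "BG (0, u) (z, 0) \<noteq> 0"
      using \<xi>u(2) BG_V_nondegenerate by (auto simp: zero_prod_def)
    have "multA (0, (0, u)) (0, (z, 0)) \<in> I" using V_mult \<xi>u(1) True by blast
    moreover have "prodG (0, u) (z, 0) = (0, snd (prodG (0, u) (z, 0)))"
      using prodG_V_in_V by (metis prod.collapse)
    ultimately have "(BG (0, u) (z, 0), (0, snd (prodG (0, u) (z, 0)))) \<in> I"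
      by (simp add: multA_Pair)
    then show ?thesis using V_scalar z by blast
  qed (use \<xi>u V_scalar in blast)
  obtain \<xi> X where X: "(\<xi>, X) \<in> I" "(\<xi>, X) \<noteq> 0"
    using \<open>I \<noteq> {0}\<close> A.subspace_0[OF I] by auto
  have "\<exists>\<eta> Y. (\<eta>, Y) \<in> I \<and> \<eta> \<noteq> 0"
  proof (cases "\<xi> = 0")
    case True
    then have "X \<noteq> 0" using X(2) by (simp add: zero_prod_def)
    then obtain Y where "BG X Y \<noteq> 0" using BG_nondegenerate by blast
    moreover have "(BG X Y, prodG X Y) \<in> I \<or> (BG X Y, prodG Y X) \<in> I"
      using mult[OF X(1), of "(0, Y)"] True BG_sym[of Y X] by (simp add: multA_Pair)
    ultimately show ?thesis by blast
  qed (use X in blast)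
  then obtain X where X: "(1, X) \<in> I" using normalize by blast
  show ?thesis
  proof (rule ccontr)
    assume "I \<noteq> UNIV"
    \<comment> \<open>The product of \<open>(0, u)\<close> and \<open>(1, X)\<close> lies in
      \<open>I\<close> and in F x V, so by \<open>V_nonzero\<close> it must vanish.\<close>
    have zero: "BG (0, u) X = 0 \<and> (0, u) + prodG (0, u) X = 0" for u
    proof -
      have "multA (0, (0, u)) (1, X) \<in> I" using V_mult X by blast
      moreover have uX: "(0, u) + prodG (0, u) X = (0, u + snd (prodG (0, u) X))"
        using prodG_V_in_V[of u X] by (metis add_Pair add_0 prod.collapse)
      ultimately have "(BG (0, u) X, (0, u + snd (prodG (0, u) X))) \<in> I"
        by (simp add: multA_Pair)
      then have "(BG (0, u) X, u + snd (prodG (0, u) X)) = 0"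
        using V_nonzero \<open>I \<noteq> UNIV\<close> by blast
      then show ?thesis unfolding uX by (simp add: zero_prod_def)
    qed
    then have "fst X \<in> range T" by (metis fst_in_range_T BG_sym)
    then have "(0, u) = (0 :: 'g \<times> 'v)" for u using zero prodG_V_eq_0 by (metis add.right_neutral)
    then show False using ex_V_nonzero by (simp add: zero_prod_def)
  qed
qed

lemma simple_algebra_A: "simple_algebra scaleA multA"
  unfolding simple_algebra_def left_ideal_def right_ideal_def nontrivial_ideal_def
  using one_sided_ideal_trivial by blast

lemma no_two_sided_ideals_A: "\<nexists>I. two_sided_ideal scaleA multA I \<and> nontrivial_ideal I"
  using simple_algebra_A unfolding simple_algebra_def two_sided_ideal_def by blast

section \<open>The quotient by the unit line as a Hom-Lie algebra\<close>

lemma muG_simps: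
  "muG (X + Y) Z = muG X Z + muG Y Z" "muG (scaleG c X) Z = scaleG c (muG X Z)"
  "muG Z (X + Y) = muG Z X + muG Z Y" "muG Z (scaleG c X) = scaleG c (muG Z X)"
  by (simp_all add: muG_def mu_simps fst_scaleG scaleG_Pair)

lemma muG_skew: "muG X Y = - muG Y X"
  by (simp add: muG_def skew_mu[of "fst X" "fst Y"])

lemma L_simps: "L (X + Y) = L X + L Y" "L (scaleG c X) = scaleG c (L X)"
  by (simp_all add: L_def k_simps fst_scaleG)

text \<open>\<open>muG\<close> sees first components only, and that of \<open>L X\<close> is
  \<open>T (fst X)\<close>, so \<open>hom_jacobi\<close> applies.\<close>

lemma muG_L_jacobi: "muG (L X) (muG Y Z) + muG (L Y) (muG Z X) + muG (L Z) (muG X Y) = 0"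
  using hom_jacobi by (simp add: muG_def L_def k_def zero_prod_def)

text \<open>Each class contains exactly one \<open>(0, X)\<close>, which identifies the quotient
  with \<GG>; the structure is transported along this bijection. Since \<open>unit_class\<close> is
  onto, the first two equations determine \<open>\<mu>'\<close> and \<open>T'\<close>.\<close>

lemma hom_lie_algebra_quotient:
  defines "sQ \<equiv> scale_mod_unit scaleG"
  shows "\<exists>\<mu>' T'.
    (\<forall>p q. \<mu>' (unit_class p) (unit_class q) = unit_class (multA p q - multA q p)) \<and>
    (\<forall>\<xi> X. T' (unit_class (\<xi>, X)) = unit_class (\<xi>, L X)) \<and>
    hom_lie_algebra sQ \<mu>' T' \<and>
    (\<exists>\<psi>. hom_lie_isomorphism sQ \<mu>' T' scaleG muG L \<psi>)"
proof -
  \<comment> \<open>The representative is arbitrary, but its second component depends on the class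
    only.\<close>
  define \<psi> where "\<psi> P = snd (rep_mod_unit P)" for P :: "('f, 'g \<times> 'v) mod_unit"
  define \<iota> where "\<iota> X = unit_class (0 :: 'f, X)" for X :: "'g \<times> 'v"
  have class_eq: "unit_class (\<xi>, X) = \<iota> X" for \<xi> X
    by (simp add: \<iota>_def unit_class_eq_iff)
  have \<psi>\<iota>: "\<psi> (\<iota> X) = X" for X
  proof -
    have "unit_class (rep_mod_unit (\<iota> X)) = \<iota> X"
      using Quotient3_abs_rep[OF Quotient3_mod_unit] .
    then show ?thesis by (simp add: \<iota>_def \<psi>_def unit_class_eq_iff)
  qed
  have ex: "\<exists>X. P = \<iota> X" for P
    by (induct P rule: mod_unit.abs_induct) (metis class_eq surj_pair)
  have \<iota>\<psi>: "\<iota> (\<psi> P) = P" for P using ex[of P] \<psi>\<iota> by auto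
  have \<iota>_add: "\<iota> X + \<iota> Y = \<iota> (X + Y)" and \<iota>_minus: "- \<iota> X = \<iota> (- X)" for X Y
    by (simp_all add: \<iota>_def plus_mod_unit.abs_eq uminus_mod_unit.abs_eq)
  have \<iota>_0: "0 = \<iota> 0"
    by (simp add: \<iota>_def zero_mod_unit_def zero_prod_def)
  have \<iota>_scale: "sQ c (\<iota> X) = \<iota> (scaleG c X)" for c X
    by (simp add: sQ_def \<iota>_def scale_mod_unit_class[OF vector_space_G] scaleA_Pair)
  \<comment> \<open>Turns each law on the quotient into the corresponding law on \<GG>, by way of
    the equations for \<open>\<iota>\<close>.\<close>
  have all: "(\<forall>P. Q P) \<longleftrightarrow> (\<forall>X. Q (\<iota> X))" for Q by (metis ex)
  have vs: "vector_space sQ"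
    unfolding vector_space_def all \<iota>_add \<iota>_scale
    by (simp add: G.scale_right_distrib G.scale_left_distrib)
  have lin\<iota>: "Vector_Spaces.linear scaleG sQ \<iota>"
    unfolding Vector_Spaces.linear_iff using vs vector_space_G by (simp add: \<iota>_add \<iota>_scale)
  have "surj \<iota>" using ex by blast
  then have fd: "\<exists>E. finite_dimensional_vector_space sQ E"
    using finite_dimensional_G finite_dimensional_linear_image lin\<iota> by blast
  \<comment> \<open>Transport along \<open>\<psi>\<close> makes well-definedness automatic; the
    prescribed values on classes are checked afterwards.\<close>
  define \<mu>' where "\<mu>' P Q = \<iota> (muG (\<psi> P) (\<psi> Q))" for P Q
  define T' where "T' P = \<iota> (L (\<psi> P))" for P
  have \<mu>'\<iota>: "\<mu>' (\<iota> X) (\<iota> Y) = \<iota> (muG X Y)" and T'\<iota>: "T' (\<iota> X) = \<iota> (L X)" for X Y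
    by (simp_all add: \<mu>'_def T'_def \<psi>\<iota>)
  have "\<mu>' (unit_class p) (unit_class q) = unit_class (multA p q - multA q p)" for p q
    by (cases p; cases q) (simp add: class_eq multA_commutator \<mu>'\<iota>)
  moreover have "T' (unit_class (\<xi>, X)) = unit_class (\<xi>, L X)" for \<xi> X
    by (simp add: class_eq T'\<iota>)
  moreover have "hom_lie_algebra sQ \<mu>' T'"
  proof -
    have "bilinear_map sQ sQ sQ \<mu>'"
      unfolding bilinear_map_def Vector_Spaces.linear_iff all \<iota>_add \<iota>_scale \<mu>'\<iota>
      using vs by (simp add: muG_simps \<iota>_add \<iota>_scale)
    moreover have "\<forall>P Q. \<mu>' P Q = - \<mu>' Q P"
      unfolding all \<mu>'\<iota> \<iota>_minus by (metis muG_skew)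
    moreover have "Vector_Spaces.linear sQ sQ T'"
      unfolding Vector_Spaces.linear_iff all \<iota>_add \<iota>_scale T'\<iota>
      using vs by (simp add: L_simps \<iota>_add \<iota>_scale)
    moreover have "\<forall>P Q R. \<mu>' (T' P) (\<mu>' Q R) + \<mu>' (T' Q) (\<mu>' R P) + \<mu>' (T' R) (\<mu>' P Q) = 0"
      unfolding all \<mu>'\<iota> T'\<iota> \<iota>_add \<iota>_0 muG_L_jacobi by simp
    ultimately show ?thesis
      unfolding hom_lie_algebra_def hom_lie_algebra_axioms_def fd_vector_space_def
        fd_vector_space_axioms_def
      using vs fd by blast
  qed
  moreover have "hom_lie_isomorphism sQ \<mu>' T' scaleG muG L \<psi>"
  proof -
    have "Vector_Spaces.linear sQ scaleG \<psi>"
      unfolding Vector_Spaces.linear_iff all \<iota>_add \<iota>_scale \<psi>\<iota>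
      using vs vector_space_G by simp
    moreover have "bij \<psi>" by (rule o_bij[of \<iota>]) (auto simp: \<psi>\<iota> \<iota>\<psi>)
    ultimately show ?thesis
      by (auto simp: hom_lie_isomorphism_def \<mu>'_def T'_def \<psi>\<iota>)
  qed
  ultimately show ?thesis by blast
qed

end

theorem theorem2p2:
  fixes scale :: "'f::{alg_closed_field, field_char_0} \<Rightarrow> 'g::ab_group_add \<Rightarrow> 'g"
    and \<mu> :: "'g \<Rightarrow> 'g \<Rightarrow> 'g" and T :: "'g \<Rightarrow> 'g" and B :: "'g \<Rightarrow> 'g \<Rightarrow> 'f"
    and scaleV :: "'f \<Rightarrow> 'v::ab_group_add \<Rightarrow> 'v"
    and r :: nat and \<aa> :: "'g set" and a :: "nat \<Rightarrow> 'g" and v :: "nat \<Rightarrow> 'v"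
  assumes "hom_lie_extension scale \<mu> T B scaleV r \<aa> a v"
  defines "scaleG \<equiv> module_prod.scale scale scaleV"
    and "scaleA \<equiv> module_prod.scale (*) (module_prod.scale scale scaleV)"
    and "muG \<equiv> hom_lie_extension.muG \<mu>"
    and "L \<equiv> hom_lie_extension.L T B scaleV r a v"
    and "multA \<equiv> hom_lie_extension.multA scale \<mu> T B scaleV r \<aa> a v"
  shows
    "(unital_algebra scaleA multA (1, 0) \<and>
      ((\<exists>x y. \<mu> x y \<noteq> 0) \<longrightarrow> (\<exists>p q. multA p q \<noteq> multA q p)) \<and>
      (\<exists>p q s. multA (multA p q) s \<noteq> multA p (multA q s))) \<and>
     (\<not> jacobi \<mu> \<and> \<not> abelian_bracket (\<lambda>x y. T (\<mu> x y)) \<longrightarrow>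
      (\<nexists>I. two_sided_ideal scaleA multA I \<and> nontrivial_ideal I) \<and>
      (nilpotent_bracket scale (\<lambda>x y. T (\<mu> x y)) \<longrightarrow> simple_algebra scaleA multA)) \<and>
     (\<exists>\<mu>' T'.
        (\<forall>p q. \<mu>' (unit_class p) (unit_class q) = unit_class (multA p q - multA q p)) \<and>
        (\<forall>\<xi> X. T' (unit_class (\<xi>, X)) = unit_class (\<xi>, L X)) \<and>
        hom_lie_algebra (scale_mod_unit scaleG) \<mu>' T' \<and>
        (\<exists>\<psi>. hom_lie_isomorphism (scale_mod_unit scaleG) \<mu>' T' scaleG muG L \<psi>))"
proof -
  note defs = scaleG_def scaleA_def muG_def L_def multA_def
  interpret hom_lie_extension scale \<mu> T B scaleV r \<aa> a v by fact
  show ?thesis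
    unfolding defs
    using unital_algebra_A multA_noncommutative multA_nonassociative no_two_sided_ideals_A
      simple_algebra_A hom_lie_algebra_quotient by blast
qed

end
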